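(* For every primitive-recursive step function $f$ (whether or not its search is total), $\emptyset\vdash(\mathcal A\cdot\mathrm{rrep}(f))\,\mathsf B$ is derivable in OGA.
   Context: **Syntax.** Terms: $t::=v_i\mid\bot\mid\mathbf 0\mid\mathbf S t\mid t=t\mid\neg t\mid t\lor t\mid\lambda t\mid t\cdot t\mid\mathcal R\mid\mathcal A$ ($v_i$, $i\in\mathbb N$, de Bruijn variables; $\lambda$ is the only binder; application associates to the left). A term is well-formed (wf) if generated by this grammar. $\bot$ is a divergent constant, $\mathcal R$ the primitive recursor, $\mathcal A$ the universal quantifier. Abbreviations: $t\,\mathsf N$ is $t=t$; $t\,\mathsf B$ is $t\lor\neg t$; $t\ne u$ is $\neg(t=u)$; $t\land u$ is $\neg(\neg t\lor\neg u)$; $t\to u$ is $\neg t\lor u$; $\underline n=\mathbf S^n\mathbf 0$. $\uparrow$ shifts all free indices up by one; $b[t]$ is the $\beta$-instance substituting $t$ for the outermost bound variable of $b$; $[v\mapsto s]$ is capture-avoiding substitution for a free variable; $\mathrm{fv}$ is the set of free variables. **Head steps** $\triangleright$: $(\lambda b)\cdot t\triangleright b[t]$; $\mathcal R\cdot g\cdot h\cdot\mathbf 0\triangleright g$; $\mathcal R\cdot g\cdot h\cdot(\mathbf S\underline n)\triangleright h\cdot\underline n\cdot(\mathcal R\cdot g\cdot h\cdot\underline n)$; if $t\triangleright t'$ then $t\cdot u\triangleright t'\cdot u$. **Rules.** Judgments are $\Gamma\vdash c$, $\Gamma$ a finite set of wf terms, $c$ a wf term (all terms in rules are wf). A proof is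 a finite list of judgments each following from earlier entries by one rule; $\Gamma\vdash c$ is derivable if it occurs in a proof. Rules ("$\Rightarrow$" from premises to conclusion, "$\Leftrightarrow$" both directions; $\Gamma$ is the context of a judgment when none is shown): $\Gamma,c\vdash c$; $\Gamma\vdash c\Rightarrow\Gamma,a\vdash c$; $\Gamma\vdash a$ and $\Gamma,a\vdash c\Rightarrow\Gamma\vdash c$; $\Gamma\vdash c\Rightarrow[v\mapsto s]\Gamma\vdash[v\mapsto s]c$; $\vdash a\Leftrightarrow\ \vdash a=\underline1$; $\vdash\neg a\Leftrightarrow\ \vdash a=\underline0$; $\vdash\neg a,\ \vdash a\Rightarrow\ \vdash c$; $\vdash a\Leftrightarrow\ \vdash\neg\neg a$; $\vdash a\Rightarrow\ \vdash a\lor b$; $\vdash b\Rightarrow\ \vdash a\lor b$; $\vdash\neg a,\ \vdash\neg b\Rightarrow\ \vdash\neg(a\lor b)$; $\vdash a\lor b,\ \Gamma,a\vdash c,\ \Gamma,b\vdash c\Rightarrow\ \vdash c$; $\vdash\neg(a\lor b)\Rightarrow\ \vdash\neg a$; $\vdash\neg(a\lor b)\Rightarrow\ \vdash\neg b$; $\vdash a\,\mathsf N\Leftrightarrow\ \vdash a=a$; $\vdash a=b\Rightarrow\ \vdash b=a$; $\vdash a=b,\ \vdash[v\mapsto a]p\Rightarrow\ \vdash[v\mapsto b]p$; $\vdash a\ne b\Rightarrow\ \vdash b\ne a$; $\vdash a\,\mathsf N,\ \vdash b\,\mathsf N\Rightarrow\ \vdash(a=b)\,\mathsf B$; $\vdash(a=b)\,\mathsf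 B\Rightarrow\ \vdash(a\,\mathsf N)\land(b\,\mathsf N)$; $\vdash\mathbf 0\,\mathsf N$; $\vdash a\,\mathsf N\Leftrightarrow\ \vdash(\mathbf S a)\,\mathsf N$; $\vdash a\,\mathsf N\Rightarrow\ \vdash\mathbf S a\ne\mathbf 0$; $\vdash a\ne b\Leftrightarrow\ \vdash\mathbf S a\ne\mathbf S b$; $\vdash\mathbf S a=\mathbf S b\Rightarrow\ \vdash a=b$; $\vdash\bot\,\mathsf N\Rightarrow\ \vdash p$; induction: $\vdash[v_i\mapsto\mathbf 0]c$, $\ v_i\,\mathsf N,c,\Gamma\vdash[v_i\mapsto\mathbf S v_i]c$, $\ \vdash a\,\mathsf N\Rightarrow\ \vdash[v_i\mapsto a]c$ if $v_i\notin\mathrm{fv}(\Gamma)$; conversion, for $c\triangleright c'$: $\vdash c'\Rightarrow\ \vdash c$; $\vdash c\Rightarrow\ \vdash c'$; $\vdash\neg c\Rightarrow\ \vdash\neg c'$; $\vdash c'\,\mathsf N\Rightarrow\ \vdash c=c'$; $\vdash m\,\mathsf N,\ \vdash(h\cdot m\cdot(\mathcal R\cdot g\cdot h\cdot m))\,\mathsf N\Rightarrow\ \vdash\mathcal R\cdot g\cdot h\cdot(\mathbf S m)=h\cdot m\cdot(\mathcal R\cdot g\cdot h\cdot m)$; $v_0\,\mathsf N,\uparrow\Gamma\vdash\uparrow f\cdot v_0\Rightarrow\Gamma\vdash\mathcal A\cdot f$; $\vdash\mathcal A\cdot f,\ \vdash a\,\mathsf N\Rightarrow\ \vdash f\cdot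 a$; $\vdash\neg(f\cdot a),\ \vdash a\,\mathsf N\Rightarrow\ \vdash\neg(\mathcal A\cdot f)$; $\Gamma\vdash\neg(\mathcal A\cdot f)$ and $v_0\,\mathsf N,\neg(\uparrow f\cdot v_0),\uparrow\Gamma\vdash\uparrow c\Rightarrow\Gamma\vdash c$. These are the rules of RGA. OGA has these and the rule ATI: $\Gamma\vdash\mathcal A\cdot(\lambda((\uparrow u\cdot v_0)\,\mathsf B))\Rightarrow\Gamma\vdash(\mathcal A\cdot u)\,\mathsf B$. **Search sentences.** A step function is a primitive recursive $f:\mathbb N^2\to\mathbb N$ presented by a primitive recursive definition (from zero, successor, projections by composition and primitive recursion). Its search at $n$ hits at step $k$ if $f(n,k)\neq0$, and hits if it hits at some step. $\mathrm{cmp}(f)$ is the closed term obtained by compiling the definition into curried $\lambda$-terms: zero functions to $\lambda\cdots\lambda\,\mathbf 0$, successor to $\lambda\,\mathbf S v_0$, projections to $\lambda\cdots\lambda\,v_i$, composition to the corresponding applications, and $F(0,\vec x)=G(\vec x)$, $F(m+1,\vec x)=H(m,F(m,\vec x),\vec x)$ to the curried term sending $y,\vec x$ to $\mathcal R\cdot(\mathrm{cmp}(G)\cdot\vec x)\cdot(\lambda\lambda\,\mathrm{cmp}(H)\cdot v_1\cdot v_0\cdot\vec x)\cdot y$ (indices of $\vec x$ shifted under the $\lambda$s). Put $\mathrm{rmat}(f,n)=\lambda(\mathrm{cmp}(f)\cdot\underline n\cdot v_0=\mathbf 0)$ and $\mathrm{rrep}(f)=\lambda\,\neg(\mathcal A\cdot\lambda(\mathrm{cmp}(f)\cdot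 v_1\cdot v_0=\mathbf 0))$. So $\mathrm{rrep}(f)\cdot\underline n\triangleright\neg(\mathcal A\cdot\mathrm{rmat}(f,n))$ expresses that the search of $f$ at $n$ hits, and $\mathcal A\cdot\mathrm{rrep}(f)$ that it hits at every $n$. *)

theory Defs
  imports "HOL-Library.FSet"
begin

section \<open>Terms\<close>

text \<open>De Bruijn terms; the datatype contains exactly the well-formed terms.\<close>

datatype tm =
    Var nat
  | Bot
  | Zero
  | Succ tm
  | Eq tm tm  (infix "\<^bold>=" 60)
  | Neg tm  ("\<^bold>\<not> _" [70] 70)
  | Dis tm tm  (infixr "\<^bold>\<or>" 55)
  | Lam tm
  | App tm tm  (infixl "\<cdot>" 90)
  | \<R>
  | \<A>

abbreviation isN :: "tm \<Rightarrow> tm" where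
  "isN t \<equiv> t \<^bold>= t"

abbreviation isB :: "tm \<Rightarrow> tm" where
  "isB t \<equiv> t \<^bold>\<or> \<^bold>\<not> t"

abbreviation Neq :: "tm \<Rightarrow> tm \<Rightarrow> tm"  (infix "\<^bold>\<noteq>" 60) where
  "t \<^bold>\<noteq> u \<equiv> \<^bold>\<not> (t \<^bold>= u)"

abbreviation Con :: "tm \<Rightarrow> tm \<Rightarrow> tm"  (infixr "\<^bold>\<and>" 56) where
  "t \<^bold>\<and> u \<equiv> \<^bold>\<not> (\<^bold>\<not> t \<^bold>\<or> \<^bold>\<not> u)"

definition num :: "nat \<Rightarrow> tm" where
  "num n = (Succ ^^ n) Zero"

text \<open>\<open>lift k\<close> raises the indices \<open>\<ge> k\<close>, i.e. those free below \<open>k\<close> binders.\<close>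

primrec lift :: "nat \<Rightarrow> tm \<Rightarrow> tm" where
  "lift k (Var i) = Var (if i < k then i else Suc i)"
| "lift k Bot = Bot"
| "lift k Zero = Zero"
| "lift k (Succ t) = Succ (lift k t)"
| "lift k (t \<^bold>= u) = (lift k t \<^bold>= lift k u)"
| "lift k (\<^bold>\<not> t) = \<^bold>\<not> lift k t"
| "lift k (t \<^bold>\<or> u) = (lift k t \<^bold>\<or> lift k u)"
| "lift k (Lam b) = Lam (lift (Suc k) b)"
| "lift k (t \<cdot> u) = lift k t \<cdot> lift k u"
| "lift k \<R> = \<R>"
| "lift k \<A> = \<A>"

abbreviation shift :: "tm \<Rightarrow> tm"  ("\<up>") where
  "\<up> \<equiv> lift 0"

text \<open>\<open>inst k t b\<close> removes the bound variable \<open>k\<close> (so higher indices drop by one), replacing it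
  by \<open>t\<close>; \<open>inst 0 t b\<close> is the beta-instance of \<open>b\<close> at \<open>t\<close>.\<close>

primrec inst :: "nat \<Rightarrow> tm \<Rightarrow> tm \<Rightarrow> tm" where
  "inst k t (Var i) = (if i < k then Var i else if i = k then t else Var (i - 1))"
| "inst k t Bot = Bot"
| "inst k t Zero = Zero"
| "inst k t (Succ a) = Succ (inst k t a)"
| "inst k t (a \<^bold>= b) = (inst k t a \<^bold>= inst k t b)"
| "inst k t (\<^bold>\<not> a) = \<^bold>\<not> inst k t a"
| "inst k t (a \<^bold>\<or> b) = (inst k t a \<^bold>\<or> inst k t b)"
| "inst k t (Lam b) = Lam (inst (Suc k) (\<up> t) b)"
| "inst k t (a \<cdot> b) = inst k t a \<cdot> inst k t b"
| "inst k t \<R> = \<R>"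
| "inst k t \<A> = \<A>"

text \<open>\<open>subst i s\<close> replaces the free variable \<open>i\<close> by \<open>s\<close> and, in contrast to \<open>inst\<close>, leaves all
  other variables unchanged.\<close>

primrec subst :: "nat \<Rightarrow> tm \<Rightarrow> tm \<Rightarrow> tm" where
  "subst i s (Var j) = (if j = i then s else Var j)"
| "subst i s Bot = Bot"
| "subst i s Zero = Zero"
| "subst i s (Succ a) = Succ (subst i s a)"
| "subst i s (a \<^bold>= b) = (subst i s a \<^bold>= subst i s b)"
| "subst i s (\<^bold>\<not> a) = \<^bold>\<not> subst i s a"
| "subst i s (a \<^bold>\<or> b) = (subst i s a \<^bold>\<or> subst i s b)"
| "subst i s (Lam b) = Lam (subst (Suc i) (\<up> s) b)"
| "subst i s (a \<cdot> b) = subst i s a \<cdot> subst i s b"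
| "subst i s \<R> = \<R>"
| "subst i s \<A> = \<A>"

primrec fv :: "tm \<Rightarrow> nat set" where
  "fv (Var i) = {i}"
| "fv Bot = {}"
| "fv Zero = {}"
| "fv (Succ a) = fv a"
| "fv (a \<^bold>= b) = fv a \<union> fv b"
| "fv (\<^bold>\<not> a) = fv a"
| "fv (a \<^bold>\<or> b) = fv a \<union> fv b"
| "fv (Lam b) = {i. Suc i \<in> fv b}"
| "fv (a \<cdot> b) = fv a \<union> fv b"
| "fv \<R> = {}"
| "fv \<A> = {}"

inductive head_step :: "tm \<Rightarrow> tm \<Rightarrow> bool"  (infix "\<rhd>" 50) where
  beta: "Lam b \<cdot> t \<rhd> inst 0 t b"
| rec_zero: "\<R> \<cdot> g \<cdot> h \<cdot> Zero \<rhd> g"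
| rec_succ: "\<R> \<cdot> g \<cdot> h \<cdot> Succ (num n) \<rhd> h \<cdot> num n \<cdot> (\<R> \<cdot> g \<cdot> h \<cdot> num n)"
| app: "t \<rhd> t' \<Longrightarrow> t \<cdot> u \<rhd> t' \<cdot> u"


section \<open>Rules and derivability\<close>

datatype jdg = Jdg "tm fset" tm  (infix "\<turnstile>" 50)

text \<open>\<open>rga_rule P J\<close>: the judgement \<open>J\<close> is the conclusion of an instance of a rule with set of
  premises \<open>P\<close>.\<close>

inductive rga_rule :: "jdg set \<Rightarrow> jdg \<Rightarrow> bool" where
  hyp: "rga_rule {} (finsert c \<Gamma> \<turnstile> c)"
| weaken: "rga_rule {\<Gamma> \<turnstile> c} (finsert a \<Gamma> \<turnstile> c)"
| cut: "rga_rule {\<Gamma> \<turnstile> a, finsert a \<Gamma> \<turnstile> c} (\<Gamma> \<turnstile> c)"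
| subst: "rga_rule {\<Gamma> \<turnstile> c} (subst i s |`| \<Gamma> \<turnstile> subst i s c)"

| true_I: "rga_rule {\<Gamma> \<turnstile> a} (\<Gamma> \<turnstile> a \<^bold>= num 1)"
| true_E: "rga_rule {\<Gamma> \<turnstile> a \<^bold>= num 1} (\<Gamma> \<turnstile> a)"
| false_I: "rga_rule {\<Gamma> \<turnstile> \<^bold>\<not> a} (\<Gamma> \<turnstile> a \<^bold>= num 0)"
| false_E: "rga_rule {\<Gamma> \<turnstile> a \<^bold>= num 0} (\<Gamma> \<turnstile> \<^bold>\<not> a)"

| neg_E: "rga_rule {\<Gamma> \<turnstile> \<^bold>\<not> a, \<Gamma> \<turnstile> a} (\<Gamma> \<turnstile> c)"
| neg_neg_I: "rga_rule {\<Gamma> \<turnstile> a} (\<Gamma> \<turnstile> \<^bold>\<not> (\<^bold>\<not> a))"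
| neg_neg_E: "rga_rule {\<Gamma> \<turnstile> \<^bold>\<not> (\<^bold>\<not> a)} (\<Gamma> \<turnstile> a)"

| dis_I1: "rga_rule {\<Gamma> \<turnstile> a} (\<Gamma> \<turnstile> a \<^bold>\<or> b)"
| dis_I2: "rga_rule {\<Gamma> \<turnstile> b} (\<Gamma> \<turnstile> a \<^bold>\<or> b)"
| neg_dis_I: "rga_rule {\<Gamma> \<turnstile> \<^bold>\<not> a, \<Gamma> \<turnstile> \<^bold>\<not> b} (\<Gamma> \<turnstile> \<^bold>\<not> (a \<^bold>\<or> b))"
| dis_E: "rga_rule {\<Gamma> \<turnstile> a \<^bold>\<or> b, finsert a \<Gamma> \<turnstile> c, finsert b \<Gamma> \<turnstile> c} (\<Gamma> \<turnstile> c)"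
| neg_dis_E1: "rga_rule {\<Gamma> \<turnstile> \<^bold>\<not> (a \<^bold>\<or> b)} (\<Gamma> \<turnstile> \<^bold>\<not> a)"
| neg_dis_E2: "rga_rule {\<Gamma> \<turnstile> \<^bold>\<not> (a \<^bold>\<or> b)} (\<Gamma> \<turnstile> \<^bold>\<not> b)"

| isN_I: "rga_rule {\<Gamma> \<turnstile> a \<^bold>= a} (\<Gamma> \<turnstile> isN a)"
| isN_E: "rga_rule {\<Gamma> \<turnstile> isN a} (\<Gamma> \<turnstile> a \<^bold>= a)"
| eq_sym: "rga_rule {\<Gamma> \<turnstile> a \<^bold>= b} (\<Gamma> \<turnstile> b \<^bold>= a)"
| eq_subst: "rga_rule {\<Gamma> \<turnstile> a \<^bold>= b, \<Gamma> \<turnstile> subst i a p} (\<Gamma> \<turnstile> subst i b p)"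
| neq_sym: "rga_rule {\<Gamma> \<turnstile> a \<^bold>\<noteq> b} (\<Gamma> \<turnstile> b \<^bold>\<noteq> a)"
| eq_isB_I: "rga_rule {\<Gamma> \<turnstile> isN a, \<Gamma> \<turnstile> isN b} (\<Gamma> \<turnstile> isB (a \<^bold>= b))"
| eq_isB_E: "rga_rule {\<Gamma> \<turnstile> isB (a \<^bold>= b)} (\<Gamma> \<turnstile> isN a \<^bold>\<and> isN b)"

| zero_isN: "rga_rule {} (\<Gamma> \<turnstile> isN Zero)"
| succ_isN_I: "rga_rule {\<Gamma> \<turnstile> isN a} (\<Gamma> \<turnstile> isN (Succ a))"
| succ_isN_E: "rga_rule {\<Gamma> \<turnstile> isN (Succ a)} (\<Gamma> \<turnstile> isN a)"
| succ_neq_zero: "rga_rule {\<Gamma> \<turnstile> isN a} (\<Gamma> \<turnstile> Succ a \<^bold>\<noteq> Zero)"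
| succ_neq_I: "rga_rule {\<Gamma> \<turnstile> a \<^bold>\<noteq> b} (\<Gamma> \<turnstile> Succ a \<^bold>\<noteq> Succ b)"
| succ_neq_E: "rga_rule {\<Gamma> \<turnstile> Succ a \<^bold>\<noteq> Succ b} (\<Gamma> \<turnstile> a \<^bold>\<noteq> b)"
| succ_inj: "rga_rule {\<Gamma> \<turnstile> Succ a \<^bold>= Succ b} (\<Gamma> \<turnstile> a \<^bold>= b)"
| bot_E: "rga_rule {\<Gamma> \<turnstile> isN Bot} (\<Gamma> \<turnstile> p)"

| induction: "\<forall>g. g |\<in>| \<Gamma> \<longrightarrow> i \<notin> fv g \<Longrightarrow>
    rga_rule {\<Gamma> \<turnstile> subst i Zero c,
              finsert (isN (Var i)) (finsert c \<Gamma>) \<turnstile> subst i (Succ (Var i)) c,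
              \<Gamma> \<turnstile> isN a}
      (\<Gamma> \<turnstile> subst i a c)"

| conv_back: "c \<rhd> c' \<Longrightarrow> rga_rule {\<Gamma> \<turnstile> c'} (\<Gamma> \<turnstile> c)"
| conv_fwd: "c \<rhd> c' \<Longrightarrow> rga_rule {\<Gamma> \<turnstile> c} (\<Gamma> \<turnstile> c')"
| conv_neg: "c \<rhd> c' \<Longrightarrow> rga_rule {\<Gamma> \<turnstile> \<^bold>\<not> c} (\<Gamma> \<turnstile> \<^bold>\<not> c')"
| conv_eq: "c \<rhd> c' \<Longrightarrow> rga_rule {\<Gamma> \<turnstile> isN c'} (\<Gamma> \<turnstile> c \<^bold>= c')"

| rec_succ: "rga_rule {\<Gamma> \<turnstile> isN m, \<Gamma> \<turnstile> isN (h \<cdot> m \<cdot> (\<R> \<cdot> g \<cdot> h \<cdot> m))}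
    (\<Gamma> \<turnstile> \<R> \<cdot> g \<cdot> h \<cdot> Succ m \<^bold>= h \<cdot> m \<cdot> (\<R> \<cdot> g \<cdot> h \<cdot> m))"

| all_I: "rga_rule {finsert (isN (Var 0)) (\<up> |`| \<Gamma>) \<turnstile> \<up> f \<cdot> Var 0} (\<Gamma> \<turnstile> \<A> \<cdot> f)"
| all_E: "rga_rule {\<Gamma> \<turnstile> \<A> \<cdot> f, \<Gamma> \<turnstile> isN a} (\<Gamma> \<turnstile> f \<cdot> a)"
| neg_all_I: "rga_rule {\<Gamma> \<turnstile> \<^bold>\<not> (f \<cdot> a), \<Gamma> \<turnstile> isN a} (\<Gamma> \<turnstile> \<^bold>\<not> (\<A> \<cdot> f))"
| neg_all_E: "rga_rule
    {\<Gamma> \<turnstile> \<^bold>\<not> (\<A> \<cdot> f),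
     finsert (isN (Var 0)) (finsert (\<^bold>\<not> (\<up> f \<cdot> Var 0)) (\<up> |`| \<Gamma>)) \<turnstile> \<up> c}
    (\<Gamma> \<turnstile> c)"

inductive oga_rule :: "jdg set \<Rightarrow> jdg \<Rightarrow> bool" where
  rga: "rga_rule P J \<Longrightarrow> oga_rule P J"
| ATI: "oga_rule {\<Gamma> \<turnstile> \<A> \<cdot> Lam (isB (\<up> u \<cdot> Var 0))} (\<Gamma> \<turnstile> isB (\<A> \<cdot> u))"

definition is_proof :: "(jdg set \<Rightarrow> jdg \<Rightarrow> bool) \<Rightarrow> jdg list \<Rightarrow> bool" where
  "is_proof rule Js \<longleftrightarrow>
     (\<forall>i < length Js. \<exists>P. P \<subseteq> set (take i Js) \<and> rule P (Js ! i))"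

definition derivable :: "(jdg set \<Rightarrow> jdg \<Rightarrow> bool) \<Rightarrow> jdg \<Rightarrow> bool" where
  "derivable rule J \<longleftrightarrow> (\<exists>Js. is_proof rule Js \<and> J \<in> set Js)"


section \<open>Primitive recursive definitions and search sentences\<close>

text \<open>\<open>PZero\<close> and \<open>PProj\<close> carry their arity, \<open>PComp n h gs\<close> the common arity \<open>n\<close> of the functions
  \<open>gs\<close> (which may be empty), and \<open>PRec n g h\<close> the number \<open>n\<close> of parameters.
  Projections count from \<open>0\<close>.\<close>

datatype prdef =
    PZero nat
  | PSucc
  | PProj nat nat
  | PComp nat prdef "prdef list"
  | PRec nat prdef prdef

inductive has_arity :: "prdef \<Rightarrow> nat \<Rightarrow> bool" where
  "has_arity (PZero n) n"
| "has_arity PSucc 1"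
| "i < n \<Longrightarrow> has_arity (PProj n i) n"
| "has_arity h (length gs) \<Longrightarrow> \<forall>g \<in> set gs. has_arity g n \<Longrightarrow> has_arity (PComp n h gs) n"
| "has_arity g n \<Longrightarrow> has_arity h (n + 2) \<Longrightarrow> has_arity (PRec n g h) (Suc n)"

fun pr_eval :: "prdef \<Rightarrow> nat list \<Rightarrow> nat" where
  "pr_eval (PZero n) xs = 0"
| "pr_eval PSucc xs = Suc (hd xs)"
| "pr_eval (PProj n i) xs = xs ! i"
| "pr_eval (PComp n h gs) xs = pr_eval h (map (\<lambda>g. pr_eval g xs) gs)"
| "pr_eval (PRec n g h) xs =
     rec_nat (pr_eval g (tl xs)) (\<lambda>m r. pr_eval h (m # r # tl xs)) (hd xs)"

definition presents_step_function :: "prdef \<Rightarrow> (nat \<Rightarrow> nat \<Rightarrow> nat) \<Rightarrow> bool" where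
  "presents_step_function d f \<longleftrightarrow> has_arity d 2 \<and> (\<forall>n k. f n k = pr_eval d [n, k])"

definition apps :: "tm \<Rightarrow> tm list \<Rightarrow> tm" where
  "apps t us = foldl App t us"

definition lams :: "nat \<Rightarrow> tm \<Rightarrow> tm" where
  "lams n t = (Lam ^^ n) t"

text \<open>The \<open>n\<close> arguments bound by \<open>lams n\<close>, first argument (outermost binder) first, as seen below
  \<open>k\<close> further binders.\<close>

definition args :: "nat \<Rightarrow> nat \<Rightarrow> tm list" where
  "args k n = map Var (rev [k..<k + n])"

text \<open>Compiled terms are closed, so they need no shifting when placed under binders.\<close>

fun cmp :: "prdef \<Rightarrow> tm" where
  "cmp (PZero n) = lams n Zero"
| "cmp PSucc = Lam (Succ (Var 0))"
| "cmp (PProj n i) = lams n (args 0 n ! i)"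
| "cmp (PComp n h gs) = lams n (apps (cmp h) (map (\<lambda>g. apps (cmp g) (args 0 n)) gs))"
| "cmp (PRec n g h) =
     lams (Suc n)
       (\<R> \<cdot> apps (cmp g) (args 0 n)
          \<cdot> Lam (Lam (apps (cmp h) (Var 1 # Var 0 # args 2 n)))
          \<cdot> Var n)"

definition rrep :: "prdef \<Rightarrow> tm" where
  "rrep d = Lam (\<^bold>\<not> (\<A> \<cdot> Lam (cmp d \<cdot> Var 1 \<cdot> Var 0 \<^bold>= Zero)))"

end

(* The rule ATI is applied twice, once for each quantifier of the sentence. It reduces the claim to
   the boolean typing of the matrix equation at two numeric variables, hence to the statement that
   compiled primitive recursive definitions provably map numbers to numbers. The latter is proved
   by recursion on the definition; object-level induction is needed only for primitive recursion. *)

theory Submission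
  imports Defs
begin

section \<open>Derived rules\<close>

lemma is_proof_append:
  assumes "is_proof rule Js" "is_proof rule Ks"
  shows "is_proof rule (Js @ Ks)"
  unfolding is_proof_def
proof (intro allI impI)
  fix i assume i: "i < length (Js @ Ks)"
  show "\<exists>P\<subseteq>set (take i (Js @ Ks)). rule P ((Js @ Ks) ! i)"
  proof (cases "i < length Js")
    case True
    then show ?thesis
      using assms(1) by (auto simp: is_proof_def nth_append)
  next
    case False
    with i have "i - length Js < length Ks" by auto
    then obtain P where "P \<subseteq> set (take (i - length Js) Ks)" "rule P (Ks ! (i - length Js))"
      using assms(2) by (auto simp: is_proof_def)
    then show ?thesis
      using False by (intro exI[of _ P]) (auto simp: nth_append)
  qed
qed

text \<open>Each premise comes with its own proof list, but a rule needs all its premises in one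
  list; finitely many lists can be concatenated.\<close>

lemma derivable_common_proof:
  assumes "finite P" "\<forall>J \<in> P. derivable rule J"
  shows "\<exists>Js. is_proof rule Js \<and> P \<subseteq> set Js"
  using assms
proof (induction P rule: finite_induct)
  case empty
  show ?case by (intro exI[of _ "[]"]) (simp add: is_proof_def)
next
  case (insert J P)
  then obtain Js Ks where "is_proof rule Js" "P \<subseteq> set Js" "is_proof rule Ks" "J \<in> set Ks"
    by (auto simp: derivable_def)
  then show ?case
    by (intro exI[of _ "Js @ Ks"]) (auto intro: is_proof_append)
qed

lemma derivable_rule:
  assumes "rule P J" "finite P" "\<forall>K \<in> P. derivable rule K"
  shows "derivable rule J"
proof -
  obtain Js where Js: "is_proof rule Js" "P \<subseteq> set Js"
    using derivable_common_proof assms(2,3) by blast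
  have "is_proof rule (Js @ [J])"
    unfolding is_proof_def
  proof (intro allI impI)
    fix i assume "i < length (Js @ [J])"
    then consider "i < length Js" | "i = length Js" by fastforce
    then show "\<exists>P\<subseteq>set (take i (Js @ [J])). rule P ((Js @ [J]) ! i)"
      using Js assms(1) by cases (auto simp: is_proof_def nth_append)
  qed
  then show ?thesis
    unfolding derivable_def by (intro exI[of _ "Js @ [J]"]) simp
qed

abbreviation oga :: "tm fset \<Rightarrow> tm \<Rightarrow> bool"  (infix "\<tturnstile>" 50) where
  "\<Gamma> \<tturnstile> c \<equiv> derivable oga_rule (\<Gamma> \<turnstile> c)"

lemma derivable_rga:
  assumes "rga_rule P J" "finite P" "\<forall>K \<in> P. derivable oga_rule K"
  shows "derivable oga_rule J"
  using derivable_rule[of oga_rule, OF oga_rule.rga] assms by blast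

section \<open>Numbers and booleans along equations and head steps\<close>

lemma oga_hyp: "c |\<in>| \<Gamma> \<Longrightarrow> \<Gamma> \<tturnstile> c"
  using derivable_rga[OF rga_rule.hyp[of c \<Gamma>]] by (simp add: finsert_absorb)

lemma oga_weaken: "\<Gamma> \<tturnstile> c \<Longrightarrow> finsert a \<Gamma> \<tturnstile> c"
  using derivable_rga[OF rga_rule.weaken] by simp

lemma oga_isN_eq: "\<Gamma> \<tturnstile> a \<^bold>= b \<Longrightarrow> \<Gamma> \<tturnstile> isN b \<Longrightarrow> \<Gamma> \<tturnstile> isN a"
  using derivable_rga[OF rga_rule.eq_subst[of \<Gamma> b a 0 "isN (Var 0)"]]
    derivable_rga[OF rga_rule.eq_sym[of \<Gamma> a b]] by simp

lemma oga_isB_eq: "\<Gamma> \<tturnstile> a \<^bold>= b \<Longrightarrow> \<Gamma> \<tturnstile> isB b \<Longrightarrow> \<Gamma> \<tturnstile> isB a"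
  using derivable_rga[OF rga_rule.eq_subst[of \<Gamma> b a 0 "isB (Var 0)"]]
    derivable_rga[OF rga_rule.eq_sym[of \<Gamma> a b]] by simp

text \<open>Once the contractum is a number, \<open>conv_eq\<close> equates the redex with it, so
  numberhood travels backwards along head steps.\<close>

lemma oga_conv_isN: "a \<rhd> b \<Longrightarrow> \<Gamma> \<tturnstile> isN b \<Longrightarrow> \<Gamma> \<tturnstile> isN a"
  using derivable_rga[OF rga_rule.conv_eq[of a b \<Gamma>]] oga_isN_eq[of \<Gamma> a b] by simp

lemma oga_convs_isN: "head_step\<^sup>*\<^sup>* a b \<Longrightarrow> \<Gamma> \<tturnstile> isN b \<Longrightarrow> \<Gamma> \<tturnstile> isN a"
  by (induction rule: converse_rtranclp_induct) (auto intro: oga_conv_isN)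

lemma oga_num_isN: "\<Gamma> \<tturnstile> isN (num n)"
proof (induction n)
  case 0
  show ?case using derivable_rga[OF rga_rule.zero_isN] by (simp add: num_def)
next
  case (Suc n)
  then show ?case using derivable_rga[OF rga_rule.succ_isN_I] by (simp add: num_def)
qed

lemma oga_dis_E:
  "\<Gamma> \<tturnstile> a \<^bold>\<or> b \<Longrightarrow> finsert a \<Gamma> \<tturnstile> c \<Longrightarrow> finsert b \<Gamma> \<tturnstile> c \<Longrightarrow> \<Gamma> \<tturnstile> c"
  using derivable_rga[OF rga_rule.dis_E[of \<Gamma> a b c]] by simp

text \<open>A boolean equals \<open>num 1\<close> or \<open>num 0\<close>, hence is a number.\<close>

lemma oga_isB_isN: "\<Gamma> \<tturnstile> isB a \<Longrightarrow> \<Gamma> \<tturnstile> isN a"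
proof (erule oga_dis_E)
  have "finsert a \<Gamma> \<tturnstile> a \<^bold>= num 1"
    using derivable_rga[OF rga_rule.true_I] by (simp add: oga_hyp)
  then show "finsert a \<Gamma> \<tturnstile> isN a" by (rule oga_isN_eq) (rule oga_num_isN)
  have "finsert (\<^bold>\<not> a) \<Gamma> \<tturnstile> a \<^bold>= num 0"
    using derivable_rga[OF rga_rule.false_I] by (simp add: oga_hyp)
  then show "finsert (\<^bold>\<not> a) \<Gamma> \<tturnstile> isN a" by (rule oga_isN_eq) (rule oga_num_isN)
qed

text \<open>Negations cannot be expanded by the conversion rules alone; the equation between redex and
  contractum is needed.\<close>

lemma oga_conv_isB: "a \<rhd> b \<Longrightarrow> \<Gamma> \<tturnstile> isB b \<Longrightarrow> \<Gamma> \<tturnstile> isB a"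
  using derivable_rga[OF rga_rule.conv_eq[of a b \<Gamma>]] oga_isB_isN[of \<Gamma> b]
    oga_isB_eq[of \<Gamma> a b]
  by simp

lemma oga_isB_Neg:
  assumes "\<Gamma> \<tturnstile> isB a"
  shows "\<Gamma> \<tturnstile> isB (\<^bold>\<not> a)"
  using assms
proof (rule oga_dis_E)
  have "finsert a \<Gamma> \<tturnstile> \<^bold>\<not> (\<^bold>\<not> a)"
    using derivable_rga[OF rga_rule.neg_neg_I[of _ a]] by (simp add: oga_hyp)
  then show "finsert a \<Gamma> \<tturnstile> isB (\<^bold>\<not> a)"
    using derivable_rga[OF rga_rule.dis_I2[of _ "\<^bold>\<not> (\<^bold>\<not> a)"]] by simp
  show "finsert (\<^bold>\<not> a) \<Gamma> \<tturnstile> isB (\<^bold>\<not> a)"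
    using derivable_rga[OF rga_rule.dis_I1[of _ "\<^bold>\<not> a"]] by (simp add: oga_hyp)
qed

text \<open>ATI with its premise unfolded by generalization and one beta step.\<close>

lemma oga_isB_all:
  assumes "finsert (isN (Var 0)) (\<up> |`| \<Gamma>) \<tturnstile> isB (\<up> u \<cdot> Var 0)"
    and "inst 0 (Var 0) (lift 1 (\<up> u)) = \<up> u"
  shows "\<Gamma> \<tturnstile> isB (\<A> \<cdot> u)"
proof -
  let ?f = "Lam (isB (\<up> u \<cdot> Var 0))"
  \<comment> \<open>Generalization lifts the body of \<open>?f\<close> at index 1, which leaves its
    bound variable alone; by the second assumption beta undoes this lift.\<close>
  have "\<up> ?f \<cdot> Var 0 \<rhd> isB (\<up> u \<cdot> Var 0)"
    using head_step.beta[of "lift 1 (isB (\<up> u \<cdot> Var 0))" "Var 0"] assms(2) by simp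
  then have "finsert (isN (Var 0)) (\<up> |`| \<Gamma>) \<tturnstile> \<up> ?f \<cdot> Var 0"
    by (rule derivable_rga[OF rga_rule.conv_back]) (simp_all add: assms(1))
  then have "\<Gamma> \<tturnstile> \<A> \<cdot> ?f"
    using derivable_rga[OF rga_rule.all_I[of \<Gamma> ?f]] by simp
  then show ?thesis
    using derivable_rule[of oga_rule, OF oga_rule.ATI[of \<Gamma> u]] by simp
qed


section \<open>Substitution\<close>

lemma finite_fv: "finite (fv t)"
proof (induction t)
  case (Lam t)
  then have "finite (Suc -` fv t)" by (intro finite_vimageI) auto
  then show ?case by (simp add: vimage_def)
qed auto

lemma subst_fresh: "i \<notin> fv t \<Longrightarrow> subst i s t = t"
  by (induction t arbitrary: i s) auto

lemma lift_above_fv: "\<forall>i \<in> fv t. i < k \<Longrightarrow> lift k t = t"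
proof (induction t arbitrary: k)
  case (Lam t)
  have "\<forall>i \<in> fv t. i < Suc k"
    using Lam.prems by (auto simp: less_Suc_eq_0_disj) (metis Suc_pred not_gr_zero)
  then show ?case using Lam.IH by simp
qed auto

lemma inst_above_fv: "\<forall>i \<in> fv t. i < k \<Longrightarrow> inst k s t = t"
proof (induction t arbitrary: k s)
  case (Lam t)
  have "\<forall>i \<in> fv t. i < Suc k"
    using Lam.prems by (auto simp: less_Suc_eq_0_disj) (metis Suc_pred not_gr_zero)
  then show ?case using Lam.IH by simp
qed auto

lemma lift_closed: "fv t = {} \<Longrightarrow> lift k t = t"
  by (simp add: lift_above_fv)

lemma inst_closed: "fv t = {} \<Longrightarrow> inst k s t = t"
  by (simp add: inst_above_fv)

lemma inst_lift: "inst k s (lift k t) = t"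
  by (induction t arbitrary: k s) auto

lemma lift_lift: "i \<le> k \<Longrightarrow> lift i (lift k t) = lift (Suc k) (lift i t)"
  by (induction t arbitrary: i k) auto

text \<open>After \<open>k\<close> shifts no free index lies below \<open>k\<close>, so lifting at
  \<open>k\<close> acts as one more shift.\<close>

lemma lift_shifts: "lift k ((\<up> ^^ k) t) = (\<up> ^^ Suc k) t"
proof (induction k)
  case (Suc k)
  then show ?case using lift_lift[of 0 k "(\<up> ^^ k) t"] by simp
qed simp

lemma inst_shifts: "inst k s ((\<up> ^^ Suc k) t) = (\<up> ^^ k) t"
  by (metis inst_lift lift_shifts)

text \<open>\<open>insts k ts b\<close> is what remains of \<open>b\<close>, seen below \<open>k\<close> further binders, after \<open>ts\<close> have been
  consumed by the \<open>length ts\<close> surrounding abstractions; the first argument belongs to the outermost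
  one.\<close>

fun insts :: "nat \<Rightarrow> tm list \<Rightarrow> tm \<Rightarrow> tm" where
  "insts k [] b = b"
| "insts k (t # ts) b = insts k ts (inst (length ts + k) ((\<up> ^^ (length ts + k)) t) b)"

lemma insts_simps [simp]:
  "insts k ts Zero = Zero"
  "insts k ts (Succ a) = Succ (insts k ts a)"
  "insts k ts (a \<cdot> b) = insts k ts a \<cdot> insts k ts b"
  "insts k ts (Lam b) = Lam (insts (Suc k) ts b)"
  "insts k ts \<R> = \<R>"
  by (induction ts arbitrary: a b) auto

lemma insts_closed: "fv b = {} \<Longrightarrow> insts k ts b = b"
  by (induction ts) (auto simp: inst_closed)

lemma insts_Var_bound: "i < k \<Longrightarrow> insts k ts (Var i) = Var i"
  by (induction ts) auto

lemma insts_shifts: "insts k ts ((\<up> ^^ (length ts + k)) t) = (\<up> ^^ k) t"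
  by (induction ts) (use inst_shifts in auto)

text \<open>Indices count from the innermost abstraction while \<open>ts\<close> starts at the
  outermost, hence the reversal.\<close>

lemma insts_Var:
  "k \<le> i \<Longrightarrow> i < k + length ts \<Longrightarrow> insts k ts (Var i) = (\<up> ^^ k) (rev ts ! (i - k))"
proof (induction ts)
  case (Cons t ts)
  show ?case
  proof (cases "i = length ts + k")
    case True
    \<comment> \<open>The variable becomes the shifted \<open>t\<close>; the remaining
      instantiations only cancel its shifts.\<close>
    then show ?thesis by (simp add: insts_shifts nth_append)
  next
    case False
    then have "i < k + length ts" "i - k < length ts" using Cons.prems by auto
    then show ?thesis using Cons False by (simp add: nth_append)
  qed
qed simp

lemma insts_apps: "insts k ts (apps a us) = apps (insts k ts a) (map (insts k ts) us)"
  unfolding apps_def by (induction us arbitrary: a) auto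

lemma length_args [simp]: "length (args k n) = n"
  by (simp add: args_def)

text \<open>\<open>args\<close> lists its indices in descending order, which cancels the reversal in
  \<open>insts_Var\<close>.\<close>

lemma insts_args: "length ts = n \<Longrightarrow> map (insts k ts) (args k n) = map (\<up> ^^ k) ts"
  by (rule nth_equalityI) (auto simp: args_def rev_nth insts_Var)

lemma lams_Suc: "lams (Suc n) b = Lam (lams n b)"
  by (simp add: lams_def)

lemma lams_0: "lams 0 b = b"
  by (simp add: lams_def)

lemma inst_lams: "inst k t (lams n b) = lams n (inst (n + k) ((\<up> ^^ n) t) b)"
  by (induction n arbitrary: k t) (auto simp: lams_0 lams_Suc funpow_swap1)

lemma apps_Cons: "apps t (u # us) = apps (t \<cdot> u) us"
  by (simp add: apps_def)

lemma head_step_apps: "t \<rhd> t' \<Longrightarrow> apps t us \<rhd> apps t' us"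
  by (induction us arbitrary: t t') (auto simp: apps_def head_step.app)

text \<open>Head steps are closed under further arguments on the right, so beta can consume
  \<open>ts\<close> one by one from the outermost abstraction.\<close>

lemma apps_lams: "length ts = n \<Longrightarrow> head_step\<^sup>*\<^sup>* (apps (lams n b) ts) (insts 0 ts b)"
proof (induction ts arbitrary: n b)
  case Nil
  then show ?case by (simp add: apps_def lams_0)
next
  case (Cons t ts)
  let ?b = "inst (length ts) ((\<up> ^^ length ts) t) b"
  have "apps (lams n b) (t # ts) \<rhd> apps (lams (length ts) ?b) ts"
    using head_step_apps[OF head_step.beta, of "lams (length ts) b" t ts] Cons.prems
    by (auto simp: apps_Cons lams_Suc inst_lams)
  then show ?case using Cons.IH[of "length ts" ?b]
    by (simp add: converse_rtranclp_into_rtranclp)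
qed


section \<open>Compiled definitions are total\<close>

lemma fv_lams: "fv (lams n t) = {i. i + n \<in> fv t}"
  by (induction n) (auto simp: lams_0 lams_Suc)

lemma fv_apps: "fv (apps t us) = fv t \<union> \<Union> (fv ` set us)"
  unfolding apps_def by (induction us arbitrary: t) auto

lemma set_args: "set (args k n) = Var ` {k..<k + n}"
  by (simp add: args_def)

text \<open>The arity conditions keep projection indices within their binders. Closedness lets
  compiled terms pass unchanged through lifting and instantiation.\<close>

lemma fv_cmp: "has_arity d n \<Longrightarrow> fv (cmp d) = {}"
proof (induction rule: has_arity.induct)
  case (3 i n)
  then show ?case by (auto simp: fv_lams args_def rev_nth)
qed (auto simp: fv_lams fv_apps set_args)

text \<open>Arguments are arbitrary provable numbers, not just numerals, and the context varies:
  composition passes unevaluated applications, and object-level induction adds hypotheses.\<close>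

lemma oga_cmp_isN:
  assumes "has_arity d n" "length ts = n" "\<forall>t \<in> set ts. \<Gamma> \<tturnstile> isN t"
  shows "\<Gamma> \<tturnstile> isN (apps (cmp d) ts)"
  using assms
proof (induction arbitrary: \<Gamma> ts rule: has_arity.induct)
  case (1 n)
  then show ?case
    using oga_convs_isN[OF apps_lams, of ts n \<Gamma> Zero] oga_num_isN[of \<Gamma> 0] by (simp add: num_def)
next
  case 2
  then obtain t where [simp]: "ts = [t]" and "\<Gamma> \<tturnstile> isN t"
    by (cases ts) auto
  then have "\<Gamma> \<tturnstile> isN (Succ t)"
    using derivable_rga[OF rga_rule.succ_isN_I] by simp
  then show ?case
    using oga_conv_isN[OF head_step.beta, of \<Gamma> t "Succ (Var 0)"] by (simp add: apps_def)
next
  case (3 i n)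
  then have "insts 0 ts (args 0 n ! i) = ts ! i"
    by (simp add: args_def rev_nth insts_Var)
  then show ?case
    using 3 oga_convs_isN[OF apps_lams, of ts n \<Gamma> "args 0 n ! i"] by simp
next
  case (4 h gs n)
  have closed: "fv (cmp h) = {}" "\<And>g. g \<in> set gs \<Longrightarrow> fv (cmp g) = {}"
    using 4 fv_cmp by blast+
  have "insts 0 ts (apps (cmp h) (map (\<lambda>g. apps (cmp g) (args 0 n)) gs))
      = apps (cmp h) (map (\<lambda>g. apps (cmp g) ts) gs)"
    using \<open>length ts = n\<close> closed
    by (auto simp: insts_apps insts_closed insts_args intro!: arg_cong[of _ _ "apps _"])
  \<comment> \<open>The hypotheses for \<open>gs\<close> make the inner applications numbers, so the
    one for \<open>h\<close> accepts them as arguments.\<close>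
  moreover have "\<Gamma> \<tturnstile> isN (apps (cmp h) (map (\<lambda>g. apps (cmp g) ts) gs))"
    using 4 by auto
  ultimately show ?case
    using \<open>length ts = n\<close>
      oga_convs_isN[OF apps_lams, of ts n \<Gamma> "apps (cmp h) (map (\<lambda>g. apps (cmp g) (args 0 n)) gs)"]
    by simp
next
  case (5 g n h)
  then obtain y us where ts: "ts = y # us" and us: "length us = n"
    by (cases ts) auto
  have y: "\<Gamma> \<tturnstile> isN y" and us_isN: "\<forall>t \<in> set us. \<Gamma> \<tturnstile> isN t"
    using 5 ts by auto
  have closed: "fv (cmp g) = {}" "fv (cmp h) = {}"
    using 5 fv_cmp by blast+
  \<comment> \<open>The base and step terms of the recursor once the parameters are filled in; the
    two shifts carry \<open>us\<close> below the two abstractions of \<open>H\<close>.\<close>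
  define G where "G = apps (cmp g) us"
  define H where "H = Lam (Lam (apps (cmp h) (Var 1 # Var 0 # map (\<up> ^^ 2) us)))"
  have body: "insts 0 ts (\<R> \<cdot> apps (cmp g) (args 0 n)
      \<cdot> Lam (Lam (apps (cmp h) (Var 1 # Var 0 # args 2 n))) \<cdot> Var n) = \<R> \<cdot> G \<cdot> H \<cdot> y"
  proof -
    \<comment> \<open>The outermost binder belongs to the recursion argument \<open>y\<close>, so
      the parameters are the tail of the full argument list.\<close>
    have drop: "map (insts k ts) (args k n) = map (\<up> ^^ k) us" for k
    proof -
      have "map (insts k ts) (args k (Suc n)) = map (\<up> ^^ k) ts"
        using ts us by (intro insts_args) simp
      then show ?thesis by (simp add: args_def ts)
    qed
    have "insts 0 ts (Var n) = y" using ts us by (simp add: insts_Var nth_append del: insts.simps)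
    then show ?thesis
      using closed drop[of 0] drop[of 2]
      by (simp add: G_def H_def insts_apps insts_closed insts_Var_bound numeral_2_eq_2)
  qed
  have H_step: "head_step\<^sup>*\<^sup>* (H \<cdot> m \<cdot> r) (apps (cmp h) (m # r # us))" for m r
  proof -
    have "insts 0 [m, r] (apps (cmp h) (Var 1 # Var 0 # map (\<up> ^^ 2) us))
        = apps (cmp h) (m # r # us)"
      using closed insts_shifts[of 0 "[m, r]"]
      by (simp add: insts_apps inst_closed inst_lift numeral_2_eq_2 comp_def)
    then show ?thesis
      using apps_lams[of "[m, r]" 2 "apps (cmp h) (Var 1 # Var 0 # map (\<up> ^^ 2) us)"]
      by (simp add: H_def apps_def lams_def numeral_2_eq_2)
  qed
  \<comment> \<open>The induction variable must be fresh for the context by the side condition, and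
    for \<open>G\<close> and \<open>H\<close> so that substitution touches only the recursion
    argument.\<close>
  have "finite (fv G \<union> fv H \<union> \<Union> (fv ` fset \<Gamma>))"
    by (simp add: finite_fv)
  then obtain i where i: "i \<notin> fv G \<union> fv H \<union> \<Union> (fv ` fset \<Gamma>)"
    using ex_new_if_finite[OF infinite_UNIV_nat] by metis
  let ?c = "isN (\<R> \<cdot> G \<cdot> H \<cdot> Var i)"
  have c: "subst i a ?c = isN (\<R> \<cdot> G \<cdot> H \<cdot> a)" for a
    using i by (simp add: subst_fresh)
  have "\<Gamma> \<tturnstile> isN G"
    using 5 us us_isN by (simp add: G_def)
  then have zero: "\<Gamma> \<tturnstile> subst i Zero ?c"
    unfolding c by (rule oga_conv_isN[OF head_step.rec_zero])
  have succ: "finsert (isN (Var i)) (finsert ?c \<Gamma>) \<tturnstile> subst i (Succ (Var i)) ?c"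
  proof -
    let ?\<Delta> = "finsert (isN (Var i)) (finsert ?c \<Gamma>)"
    \<comment> \<open>The object-level hypothesis makes the recursive value a number, so the
      hypothesis for \<open>h\<close> applies to it.\<close>
    have "\<forall>t \<in> set (Var i # (\<R> \<cdot> G \<cdot> H \<cdot> Var i) # us). ?\<Delta> \<tturnstile> isN t"
      using us_isN by (auto intro: oga_weaken oga_hyp)
    then have "?\<Delta> \<tturnstile> isN (apps (cmp h) (Var i # (\<R> \<cdot> G \<cdot> H \<cdot> Var i) # us))"
      using 5 us by simp
    then have HN: "?\<Delta> \<tturnstile> isN (H \<cdot> Var i \<cdot> (\<R> \<cdot> G \<cdot> H \<cdot> Var i))"
      by (rule oga_convs_isN[OF H_step])
    \<comment> \<open>The head step for successors covers only numerals; for the variable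
      \<open>Var i\<close> the rule \<open>rec_succ\<close> is used, whose second premise is
      \<open>HN\<close>.\<close>
    then have "?\<Delta> \<tturnstile> \<R> \<cdot> G \<cdot> H \<cdot> Succ (Var i) \<^bold>= H \<cdot> Var i \<cdot> (\<R> \<cdot> G \<cdot> H \<cdot> Var i)"
      using derivable_rga[OF rga_rule.rec_succ] by (simp add: oga_hyp)
    then show ?thesis
      unfolding c using HN by (rule oga_isN_eq)
  qed
  have "\<Gamma> \<tturnstile> subst i y ?c"
    using i zero succ y by (intro derivable_rga[OF rga_rule.induction]) auto
  then have "\<Gamma> \<tturnstile> isN (\<R> \<cdot> G \<cdot> H \<cdot> y)"
    unfolding c .
  then show ?case
    using oga_convs_isN[OF apps_lams[of ts "Suc n"]] ts us body by simp
qed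

section \<open>Boolean typing of the search sentence\<close>

theorem theorem4p3:
  fixes f :: "nat \<Rightarrow> nat \<Rightarrow> nat" and d :: prdef
  assumes "presents_step_function d f"
  shows "derivable oga_rule ({||} \<turnstile> isB (\<A> \<cdot> rrep d))"
proof -
  have d: "has_arity d 2"
    using assms by (simp add: presents_step_function_def)
  note closed = lift_closed[OF fv_cmp[OF d]] inst_closed[OF fv_cmp[OF d]]
  \<comment> \<open>The contexts below the outer and below both quantifiers: in
    \<open>?\<Delta>\<close>, \<open>Var 1\<close> is the search argument and \<open>Var 0\<close>
    the step.\<close>
  let ?\<Gamma> = "{|isN (Var 0)|}"
  let ?\<Delta> = "finsert (isN (Var 0)) (\<up> |`| ?\<Gamma>)"
  let ?w = "Lam (cmp d \<cdot> Var 1 \<cdot> Var 0 \<^bold>= Zero)"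
  have "?\<Delta> \<tturnstile> isN (cmp d \<cdot> Var 1 \<cdot> Var 0)"
    using oga_cmp_isN[OF d, of "[Var 1, Var 0]" ?\<Delta>] by (simp add: apps_def oga_hyp)
  moreover have "?\<Delta> \<tturnstile> isN Zero"
    using oga_num_isN[of _ 0] by (simp add: num_def)
  ultimately have "?\<Delta> \<tturnstile> isB (cmp d \<cdot> Var 1 \<cdot> Var 0 \<^bold>= Zero)"
    using derivable_rga[OF rga_rule.eq_isB_I] by simp
  moreover have "\<up> ?w \<cdot> Var 0 \<rhd> (cmp d \<cdot> Var 1 \<cdot> Var 0 \<^bold>= Zero)"
    \<comment> \<open>Lifting \<open>?w\<close> raises its free \<open>Var 1\<close> to
      \<open>Var 2\<close>; beta lowers it again.\<close>
    using head_step.beta[of "cmp d \<cdot> Var 2 \<cdot> Var 0 \<^bold>= Zero" "Var 0"]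
    by (simp add: closed numeral_2_eq_2)
  ultimately have "?\<Delta> \<tturnstile> isB (\<up> ?w \<cdot> Var 0)"
    using oga_conv_isB by blast
  then have "?\<Gamma> \<tturnstile> isB (\<A> \<cdot> ?w)"
    by (rule oga_isB_all) (simp add: closed)
  then have "?\<Gamma> \<tturnstile> isB (\<^bold>\<not> (\<A> \<cdot> ?w))"
    by (rule oga_isB_Neg)
  moreover have "\<up> (rrep d) \<cdot> Var 0 \<rhd> \<^bold>\<not> (\<A> \<cdot> ?w)"
    using head_step.beta[of "\<^bold>\<not> (\<A> \<cdot> ?w)" "Var 0"] by (simp add: rrep_def closed)
  ultimately have "?\<Gamma> \<tturnstile> isB (\<up> (rrep d) \<cdot> Var 0)"
    by (metis oga_conv_isB)
  then show ?thesis
    by (intro oga_isB_all) (simp_all add: rrep_def closed)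
qed

end
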